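(* Let $X$ be a UMD-space and let $\tau:\mathcal{D}\to\mathcal{D}$ be a permutation (bijection) such that $|\tau(I)|=|I|$ for all $I\in\mathcal{D}$. If, for some $p\in(1,2)$, the operator $$\mathrm{Id}_X\otimes T_\tau: L^p_{X,0}\to L^p_X$$ is bounded, then $$\mathrm{Id}_X\otimes T_\tau: L^q_{X,0}\to L^q_X$$ is bounded for all $q\in(1,p)$.
   Context: $\mathcal{D}$ is the set of all dyadic intervals contained in $[0,1)$ (intervals $[j2^{-k},(j+1)2^{-k})$, $k\ge 0$, $0\le j<2^k$), and $\mathcal{D}_k$ the set of those of length $2^{-k}$; $|I|$ denotes Lebesgue measure. $h_I$ is the $L_\infty$-normalized Haar function supported on $I$ ($+1$ on the left half of $I$, $-1$ on the right half, $0$ elsewhere). Banach spaces are over $\mathbb{K}\in\{\mathbb{R},\mathbb{C}\}$ and have dimension at least one. $L^p_X=L^p_X([0,1))$ is the Bochner space with Lebesgue measure and $L^p_{X,0}$ its subspace of mean zero functions. For an injective map $\tau:\mathcal{D}\to\mathcal{D}$ with $|\tau(I)|=|I|$ and a Banach space $X$, the rearrangement operator $\mathrm{Id}_X\otimes T_\tau$ maps $\sum_I a_I h_I$ to $\sum_I a_I h_{\tau(I)}$ for finitely supported $(a_I)_{I\in\mathcal{D}}\subseteq X$. It is called bounded from $L^p_{X,0}$ to $L^p_X$ if $$\sup\Big\{\Big\|\sum_{I} a_I h_{\tau(I)}\Big\|_{L^p_X}:\Big\|\sum_I a_I h_I\Big\|_{L^p_X}\le 1\Big\}<\infty,$$ the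 supremum being over finitely supported families $(a_I)\subseteq X$. $X$ is a UMD-space if for some (equivalently, all) $p\in(1,\infty)$ there is a constant $c_p>0$ with $\sup_{\theta_k\in[-1,1]}\|\sum_{k=1}^n\theta_k d_k\|_{L^p_X}\le c_p\|\sum_{k=1}^n d_k\|_{L^p_X}$ for all $n\ge1$ and all $X$-valued martingale difference sequences $(d_k)_{k=1}^n$ with respect to the dyadic filtration $\mathcal{F}_k=\sigma(\mathcal{D}_k)$, $k=0,\dots,n$ (i.e. $d_k$ is $\mathcal{F}_k$-measurable and $\mathbb{E}(d_k|\mathcal{F}_{k-1})=0$). *)

theory Defs
  imports "HOL-Analysis.Analysis"
begin

definition dyadic_level :: "nat \<Rightarrow> real set set" where
  "dyadic_level k = {{real j / 2 ^ k ..< (real j + 1) / 2 ^ k} | j. j < (2::nat) ^ k}"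

definition dyadic :: "real set set" where
  "dyadic = (\<Union>k. dyadic_level k)"

definition haar :: "real set \<Rightarrow> real \<Rightarrow> real" where
  "haar I t = indicator {Inf I ..< (Inf I + Sup I) / 2} t
            - indicator {(Inf I + Sup I) / 2 ..< Sup I} t"

text \<open>
  The integral is total and returns 0 for non-integrable functions. This is harmless here: the norm
  is only taken of functions that are dyadic step functions on $[0,1)$, hence bounded and Borel.
\<close>

definition Lp_norm :: "real \<Rightarrow> (real \<Rightarrow> 'a::real_normed_vector) \<Rightarrow> real" where
  "Lp_norm p f = (LINT t:{0..<1}|lborel. norm (f t) powr p) powr (1 / p)"

definition dyadic_filtration :: "nat \<Rightarrow> real measure" where
  "dyadic_filtration k = sigma {0..<1} (dyadic_level k)"

text \<open>
  The condition $E(d_k \mid F_{k-1}) = 0$ is expressed by the defining property of conditional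
  expectations. The gauge integral is used because the library's Bochner integral requires a
  separable range space; both agree on the dyadic step functions $d_k$.
\<close>

definition dyadic_mds :: "nat \<Rightarrow> (nat \<Rightarrow> real \<Rightarrow> 'a::banach) \<Rightarrow> bool" where
  "dyadic_mds n d \<longleftrightarrow>
     (\<forall>k\<in>{1..n}. d k \<in> borel_measurable (dyadic_filtration k) \<and>
        (\<forall>A\<in>sets (dyadic_filtration (k - 1)). (d k has_integral 0) A))"

definition UMD :: "'a::banach itself \<Rightarrow> bool" where
  "UMD _ \<longleftrightarrow>
     (\<exists>p>1. \<exists>c>0. \<forall>n\<ge>1. \<forall>d :: nat \<Rightarrow> real \<Rightarrow> 'a. dyadic_mds n d \<longrightarrow>
        (\<forall>\<theta> :: nat \<Rightarrow> real. (\<forall>k\<in>{1..n}. \<theta> k \<in> {-1..1}) \<longrightarrow>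
           Lp_norm p (\<lambda>t. \<Sum>k=1..n. \<theta> k *\<^sub>R d k t) \<le> c * Lp_norm p (\<lambda>t. \<Sum>k=1..n. d k t)))"

definition dyadic_support :: "(real set \<Rightarrow> 'a::zero) \<Rightarrow> real set set" where
  "dyadic_support a = {I \<in> dyadic. a I \<noteq> 0}"

definition haar_sum :: "(real set \<Rightarrow> real set) \<Rightarrow> (real set \<Rightarrow> 'a::real_vector) \<Rightarrow> real \<Rightarrow> 'a" where
  "haar_sum \<tau> a t = (\<Sum>I\<in>dyadic_support a. haar (\<tau> I) t *\<^sub>R a I)"

definition rearrangement_bounded ::
  "'a::banach itself \<Rightarrow> (real set \<Rightarrow> real set) \<Rightarrow> real \<Rightarrow> bool" where
  "rearrangement_bounded _ \<tau> p \<longleftrightarrow>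
     bdd_above {Lp_norm p (haar_sum \<tau> a) | a :: real set \<Rightarrow> 'a.
       finite (dyadic_support a) \<and> Lp_norm p (haar_sum id a) \<le> 1}"

end

theory Submission
  imports Defs
begin

text \<open>
  The idea is the classical extrapolation from \<open>L\<^sup>p\<close> down to a weak type \<open>(1, 1)\<close>-like estimate,
  followed by Marcinkiewicz interpolation. Write \<open>T\<close> for the rearrangement operator and \<open>C\<close> for a constant
  with \<open>\<parallel>T f\<parallel>\<^sub>p\<^sup>p \<le> C \<parallel>f\<parallel>\<^sub>p\<^sup>p\<close>.

  The geometric core is \<open>card_image_descendants_le\<close>: there is a constant \<open>A\<close> such that for each dyadic \<open>I\<close>
  the union of all \<open>\<tau>(J)\<close> with \<open>J \<subseteq> I\<close> has measure at most \<open>A |I|\<close>. If the union were much larger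
  than \<open>I\<close>, one could choose intervals \<open>J \<subseteq> I\<close> whose images are disjoint and cover the union. The sum of
  their Haar functions is squeezed into \<open>I\<close>, where its \<open>L\<^sup>p\<close> norm is dominated through its \<open>L\<^sup>2\<close> norm,
  while its image is spread out with absolute value \<open>1\<close>. As \<open>p < 2\<close>, spreading out increases the
  \<open>L\<^sup>p\<close> norm at a given \<open>L\<^sup>2\<close> norm, and the boundedness of \<open>T\<close> limits how much of it is possible.

  Consequently \<open>T\<close> maps a mean zero function living on \<open>I\<close> to a function living on a set of measure at
  most \<open>A |I|\<close>. In the Calderon--Zygmund decomposition at height \<open>l\<close> of a finite Haar sum
  (\<open>calderon_zygmund\<close>) the bad part is a sum of such pieces, so its image is
  supported in a small set, while the image of the bounded good part is estimated in \<open>L\<^sup>p\<close>. The result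
  (\<open>weak_type_estimate\<close>) bounds the measure of the set where \<open>|T f| \<ge> l\<close> by a constant times
  the integral of \<open>|f| / l\<close> over \<open>{|f| > l / 2}\<close> plus that of \<open>(|f| / l)\<^sup>p\<close> over \<open>{|f| \<le> l}\<close>. Integrating
  against \<open>q l powr (q - 1)\<close> yields the bound in \<open>L\<^sup>q\<close> for \<open>1 < q < p\<close> (\<open>discrete_marcinkiewicz\<close>).

  A finite Haar sum is a step function on the intervals of some level \<open>N\<close>, so all norms and measures
  can be computed by sums and cardinalities over the left endpoints of these intervals. The constants
  do not depend on \<open>N\<close>.
\<close>

section \<open>Dyadic intervals and Haar functions\<close>

definition cell :: "nat \<Rightarrow> real \<Rightarrow> real set" where
  "cell k t = {real_of_int \<lfloor>2 ^ k * t\<rfloor> / 2 ^ k ..< (real_of_int \<lfloor>2 ^ k * t\<rfloor> + 1) / 2 ^ k}"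

lemma mem_cell_iff: "s \<in> cell k t \<longleftrightarrow> \<lfloor>2 ^ k * s\<rfloor> = \<lfloor>2 ^ k * t\<rfloor>"
proof -
  have "s \<in> cell k t \<longleftrightarrow> real_of_int \<lfloor>2 ^ k * t\<rfloor> \<le> 2 ^ k * s \<and> 2 ^ k * s < real_of_int \<lfloor>2 ^ k * t\<rfloor> + 1"
    by (simp add: cell_def pos_divide_le_eq pos_less_divide_eq mult.commute)
  also have "\<dots> \<longleftrightarrow> \<lfloor>2 ^ k * s\<rfloor> = \<lfloor>2 ^ k * t\<rfloor>"
    by (auto simp: floor_eq_iff)
  finally show ?thesis .
qed

lemma mem_cell_self: "t \<in> cell k t"
  by (simp add: mem_cell_iff)

lemma cell_in_level:
  assumes "t \<in> {0..<1}"
  shows "cell k t \<in> dyadic_level k"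
proof -
  have "0 \<le> \<lfloor>2 ^ k * t\<rfloor>" using assms by simp
  moreover have "\<lfloor>2 ^ k * t\<rfloor> < 2 ^ k" using assms by (simp add: floor_less_iff)
  ultimately have "nat \<lfloor>2 ^ k * t\<rfloor> < 2 ^ k" "real (nat \<lfloor>2 ^ k * t\<rfloor>) = of_int \<lfloor>2 ^ k * t\<rfloor>"
    by (auto simp: nat_less_iff)
  then show ?thesis unfolding dyadic_level_def cell_def
    by (intro CollectI exI[of _ "nat \<lfloor>2 ^ k * t\<rfloor>"]) simp
qed

lemma dyadic_levelE:
  assumes "I \<in> dyadic_level k"
  obtains j where "j < (2::nat) ^ k" "I = {real j / 2 ^ k ..< (real j + 1) / 2 ^ k}"
  using assms by (auto simp: dyadic_level_def)

lemma dyadic_level_subset_unit: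
  assumes "I \<in> dyadic_level k"
  shows "I \<subseteq> {0..<1}"
proof -
  obtain j where j: "j < (2::nat) ^ k" and I: "I = {real j / 2 ^ k ..< (real j + 1) / 2 ^ k}"
    using assms by (rule dyadic_levelE)
  have "real (j + 1) \<le> real (2 ^ k)" using j by (intro of_nat_mono) simp
  then have "(real j + 1) / 2 ^ k \<le> 1" by (simp add: divide_le_eq)
  moreover have "0 \<le> real j / 2 ^ k" by simp
  ultimately show ?thesis unfolding I ivl_subset by blast
qed

lemma dyadic_level_eq_cell:
  assumes "I \<in> dyadic_level k" "t \<in> I"
  shows "I = cell k t"
proof -
  obtain j where I: "I = {real j / 2 ^ k ..< (real j + 1) / 2 ^ k}"
    using assms(1) by (rule dyadic_levelE)
  have "\<lfloor>2 ^ k * t\<rfloor> = int j"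
    using assms(2) unfolding I by (simp add: floor_eq_iff field_simps)
  then show ?thesis unfolding I cell_def by simp
qed

text \<open>
  The index of the cell of level \<open>k\<close> is the integer quotient of the index of the cell of a finer level
  \<open>l\<close> by \<open>2 ^ (l - k)\<close>. This is the source of the nestedness of dyadic intervals.
\<close>

lemma cell_coarsen:
  assumes "s \<in> cell l t" "k \<le> l"
  shows "s \<in> cell k t"
proof -
  have *: "\<lfloor>2 ^ k * u\<rfloor> = \<lfloor>2 ^ l * u\<rfloor> div 2 ^ (l - k)" for u :: real
  proof -
    have "\<lfloor>2 ^ l * u / real_of_int (2 ^ (l - k))\<rfloor> = \<lfloor>2 ^ l * u\<rfloor> div 2 ^ (l - k)"
      by (rule floor_divide_real_eq_div) simp
    moreover have "(2::real) ^ l = 2 ^ k * 2 ^ (l - k)"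
      using assms(2) by (simp flip: power_add)
    then have "2 ^ l * u / real_of_int (2 ^ (l - k)) = 2 ^ k * u"
      by simp
    ultimately show ?thesis by simp
  qed
  show ?thesis using assms(1) unfolding mem_cell_iff by (simp add: *)
qed

lemma dyadic_level_nested:
  assumes "I \<in> dyadic_level k" "J \<in> dyadic_level l" "k \<le> l" "t \<in> I" "t \<in> J"
  shows "J \<subseteq> I"
  using assms cell_coarsen dyadic_level_eq_cell by blast

lemma dyadic_level_ne: "I \<in> dyadic_level k \<Longrightarrow> I \<noteq> {}"
  by (erule dyadic_levelE) (simp add: divide_strict_right_mono)

lemma measure_dyadic_level:
  assumes "I \<in> dyadic_level k"
  shows "measure lborel I = 1 / 2 ^ k"
proof -
  obtain j where I: "I = {real j / 2 ^ k ..< (real j + 1) / 2 ^ k}"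
    using assms(1) by (rule dyadic_levelE)
  have "real j / 2 ^ k \<le> (real j + 1) / 2 ^ k" by (simp add: divide_right_mono)
  then show ?thesis unfolding I by (simp add: diff_divide_distrib[symmetric])
qed

lemma dyadic_level_unique:
  assumes "I \<in> dyadic_level k" "J \<in> dyadic_level l" "measure lborel I = measure lborel J"
  shows "k = l"
  using assms by (simp add: measure_dyadic_level)

lemma haar_halves:
  assumes "I \<in> dyadic_level k"
  obtains L R where "L \<in> dyadic_level (Suc k)" "R \<in> dyadic_level (Suc k)" "L \<union> R = I"
    "L \<inter> R = {}" "\<And>t. haar I t = indicator L t - indicator R t"
proof -
  obtain j where j: "j < (2::nat) ^ k" and I: "I = {real j / 2 ^ k ..< (real j + 1) / 2 ^ k}"
    using assms by (rule dyadic_levelE)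
  have less: "real j / 2 ^ k < (real j + 1) / 2 ^ k"
    by (simp add: divide_strict_right_mono)
  have inf: "Inf I = real j / 2 ^ k" and sup: "Sup I = (real j + 1) / 2 ^ k"
    unfolding I using less by simp_all
  have mid: "(Inf I + Sup I) / 2 = (2 * real j + 1) / 2 ^ Suc k"
    unfolding inf sup by (simp add: field_simps)
  have ends: "real j / 2 ^ k = real (2 * j) / 2 ^ Suc k"
    "(real j + 1) / 2 ^ k = (real (2 * j + 1) + 1) / 2 ^ Suc k"
    by (simp_all add: field_simps)
  let ?L = "{Inf I ..< (Inf I + Sup I) / 2}" and ?R = "{(Inf I + Sup I) / 2 ..< Sup I}"
  have "?L = {real (2 * j) / 2 ^ Suc k ..< (real (2 * j) + 1) / 2 ^ Suc k}"
    unfolding mid unfolding inf ends(1) by simp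
  then have "?L \<in> dyadic_level (Suc k)"
    unfolding dyadic_level_def using j by (intro CollectI exI[of _ "2 * j"]) simp
  moreover have "?R = {real (2 * j + 1) / 2 ^ Suc k ..< (real (2 * j + 1) + 1) / 2 ^ Suc k}"
    unfolding mid unfolding sup ends(2) by (simp add: add.commute)
  then have "?R \<in> dyadic_level (Suc k)"
    unfolding dyadic_level_def using j by (intro CollectI exI[of _ "2 * j + 1"]) simp
  moreover have "?L \<union> ?R = I"
    using less unfolding inf sup unfolding I by (auto simp: field_simps)
  moreover have "?L \<inter> ?R = {}" by auto
  ultimately show thesis using that haar_def by blast
qed

lemma haar_outside: "I \<in> dyadic_level k \<Longrightarrow> t \<notin> I \<Longrightarrow> haar I t = 0"
  by (erule haar_halves) (auto simp: indicator_def)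

lemma abs_haar_inside: "I \<in> dyadic_level k \<Longrightarrow> t \<in> I \<Longrightarrow> \<bar>haar I t\<bar> = 1"
  by (erule haar_halves) (auto simp: indicator_def)

lemma haar_const_on_finer:
  assumes "I \<in> dyadic_level k" "k < l" "J \<in> dyadic_level l" "s \<in> J" "t \<in> J"
  shows "haar I s = haar I t"
proof -
  obtain L R where LR: "L \<in> dyadic_level (Suc k)" "R \<in> dyadic_level (Suc k)"
    "L \<union> R = I" "L \<inter> R = {}" "\<And>t. haar I t = indicator L t - indicator R t"
    using haar_halves[OF assms(1)] by blast
  have "s \<in> K \<longleftrightarrow> t \<in> K" if "K \<in> dyadic_level (Suc k)" for K
    using dyadic_level_nested[OF that assms(3)] assms by (metis Suc_leI subsetD)
  then show ?thesis using LR by (simp add: indicator_def)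
qed

section \<open>Reduction to finite sums over a grid\<close>

text \<open>
  One sample point from each dyadic interval of level \<open>N\<close>, namely its left endpoint. Up to the
  factor \<open>2 ^ N\<close>, counting grid points is Lebesgue measure on unions of intervals of level \<open>N\<close>.
\<close>

definition grid :: "nat \<Rightarrow> real set" where
  "grid N = (\<lambda>i. real i / 2 ^ N) ` {..<2 ^ N}"

lemma finite_grid [simp]: "finite (grid N)"
  by (simp add: grid_def)

lemma grid_subset_unit: "grid N \<subseteq> {0..<1}"
  by (auto simp: grid_def divide_less_eq)

lemma inj_grid: "inj_on (\<lambda>i. real i / 2 ^ N) A"
  by (auto simp: inj_on_def)

lemma card_grid_dyadic_level:
  assumes "I \<in> dyadic_level k" "k \<le> N"
  shows "card (grid N \<inter> I) = 2 ^ (N - k)"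
proof -
  obtain j where j: "j < (2::nat) ^ k" and I: "I = {real j / 2 ^ k ..< (real j + 1) / 2 ^ k}"
    using assms(1) by (rule dyadic_levelE)
  define m where "m = (2::nat) ^ (N - k)"
  have N: "(2::nat) ^ N = 2 ^ k * m" using assms(2) by (simp add: m_def flip: power_add)
  have NR: "(2::real) ^ N = 2 ^ k * real m" using assms(2) by (simp add: m_def flip: power_add)
  have m0: "0 < m" by (simp add: m_def)
  have mem: "real i / 2 ^ N \<in> I \<longleftrightarrow> j * m \<le> i \<and> i < (j + 1) * m" for i
  proof -
    have "real i / 2 ^ N \<in> I \<longleftrightarrow> real j * real m \<le> real i \<and> real i < (real j + 1) * real m"
      unfolding I NR using m0 by (simp add: field_simps)
    also have "\<dots> \<longleftrightarrow> real (j * m) \<le> real i \<and> real i < real ((j + 1) * m)"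
      by (simp add: algebra_simps)
    finally show ?thesis by (simp only: of_nat_le_iff of_nat_less_iff)
  qed
  have "(j + 1) * m \<le> 2 ^ N" unfolding N using j by (intro mult_right_mono) auto
  then have "{..<2 ^ N} \<inter> {i. real i / 2 ^ N \<in> I} = {j * m..<(j + 1) * m}"
    unfolding mem by auto
  moreover have "grid N \<inter> I = (\<lambda>i. real i / 2 ^ N) ` ({..<2 ^ N} \<inter> {i. real i / 2 ^ N \<in> I})"
    unfolding grid_def by auto
  ultimately have "grid N \<inter> I = (\<lambda>i. real i / 2 ^ N) ` {j * m..<(j + 1) * m}"
    by simp
  then have "card (grid N \<inter> I) = card {j * m..<(j + 1) * m}"
    by (simp only: card_image[OF inj_grid])
  then show ?thesis by (simp add: m_def)
qed

text \<open>
  The hypothesis \<open>k < N\<close> is what makes the two halves of \<open>I\<close> contain equally many grid points.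
\<close>

lemma sum_haar_eq_0:
  assumes "I \<in> dyadic_level k" "k < N" "J \<in> dyadic_level l" "l \<le> k"
  shows "(\<Sum>t\<in>grid N \<inter> J. haar I t) = 0"
proof (cases "I \<subseteq> J")
  case True
  obtain L R where LR: "L \<in> dyadic_level (Suc k)" "R \<in> dyadic_level (Suc k)" "L \<union> R = I"
    "L \<inter> R = {}" "\<And>t. haar I t = indicator L t - indicator R t"
    using haar_halves[OF assms(1)] by blast
  have "(\<Sum>t\<in>grid N \<inter> J. haar I t) = real (card (grid N \<inter> J \<inter> L)) - real (card (grid N \<inter> J \<inter> R))"
    by (simp add: LR(5) sum_subtractf sum.If_cases indicator_def)
  moreover have "grid N \<inter> J \<inter> L = grid N \<inter> L" "grid N \<inter> J \<inter> R = grid N \<inter> R"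
    using True LR(3) by auto
  ultimately show ?thesis
    using LR(1,2) assms(2) by (simp add: card_grid_dyadic_level)
next
  case False
  then have "I \<inter> J = {}" using assms dyadic_level_nested by blast
  then show ?thesis using haar_outside[OF assms(1)] by (intro sum.neutral) blast
qed

text \<open>
  On \<open>[0, 1)\<close> the integrand is a finite linear combination of indicators of cells of level \<open>N\<close>,
  each of measure \<open>1 / 2 ^ N\<close>, with its value at the sample point as coefficient.
\<close>

lemma Lp_norm_eq_grid_sum:
  fixes f :: "real \<Rightarrow> 'a::real_normed_vector"
  assumes "\<And>I s t. I \<in> dyadic_level N \<Longrightarrow> s \<in> I \<Longrightarrow> t \<in> I \<Longrightarrow> f s = f t"
  shows "Lp_norm p f = ((\<Sum>t\<in>grid N. norm (f t) powr p) / 2 ^ N) powr (1 / p)"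
proof -
  define g where "g t = norm (f t) powr p" for t
  have meas: "measure lborel (cell N s) = 1 / 2 ^ N" if "s \<in> grid N" for s
    using that grid_subset_unit measure_dyadic_level cell_in_level by blast
  have step: "indicator {0..<1} t *\<^sub>R g t = (\<Sum>s\<in>grid N. indicator (cell N s) t *\<^sub>R g s)" for t
  proof (cases "t \<in> {0..<1}")
    case True
    have "card (grid N \<inter> cell N t) = 2 ^ (N - N)"
      by (intro card_grid_dyadic_level cell_in_level True) simp
    then obtain u where u: "grid N \<inter> cell N t = {u}"
      by (auto simp: card_1_singleton_iff)
    have sym: "s \<in> cell N t \<longleftrightarrow> t \<in> cell N s" for s by (auto simp: mem_cell_iff)
    have "(\<Sum>s\<in>grid N. indicator (cell N s) t *\<^sub>R g s) = (\<Sum>s\<in>grid N. if s \<in> cell N t then g s else 0)"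
      by (intro sum.cong) (auto simp: indicator_def sym)
    also have "\<dots> = (\<Sum>s\<in>grid N \<inter> cell N t. g s)"
      by (simp add: sum.inter_restrict)
    also have "\<dots> = g u" by (simp add: u)
    also have "\<dots> = g t"
    proof -
      have "u \<in> cell N t" using u by blast
      then show ?thesis
        using assms[OF cell_in_level[OF True] _ mem_cell_self] by (simp add: g_def)
    qed
    finally show ?thesis using True by simp
  next
    case False
    have "t \<notin> cell N s" if "s \<in> grid N" for s
      using that False grid_subset_unit cell_in_level dyadic_level_subset_unit by blast
    then show ?thesis using False by (simp add: sum.neutral)
  qed
  have "(LINT t:{0..<1}|lborel. g t) = (\<Sum>s\<in>grid N. measure lborel (cell N s) *\<^sub>R g s)"
  proof -
    have hb: "has_bochner_integral lborel (\<lambda>t. indicator (cell N s) t *\<^sub>R g s)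
        (measure lborel (cell N s) *\<^sub>R g s)" for s
      by (intro has_bochner_integral_scaleR_left has_bochner_integral_real_indicator)
        (auto simp: cell_def divide_right_mono)
    show ?thesis unfolding set_lebesgue_integral_def step
      by (intro has_bochner_integral_integral_eq has_bochner_integral_sum hb)
  qed
  also have "\<dots> = (\<Sum>s\<in>grid N. g s) / 2 ^ N"
    by (simp add: meas sum_divide_distrib)
  finally show ?thesis unfolding Lp_norm_def g_def by simp
qed

definition dyadic_below :: "nat \<Rightarrow> real set set" where
  "dyadic_below N = (\<Union>k<N. dyadic_level k)"

text \<open>
  The same function as \<^const>\<open>haar_sum\<close> for coefficients supported in levels below \<open>N\<close>, but summed
  over an index set that does not depend on the coefficients; it is therefore linear in \<open>a\<close> on the
  nose. With \<open>\<sigma> = id\<close> it also serves as the conditional expectation of level \<open>N\<close> of any longer Haar sum.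
\<close>

definition haar_comb ::
  "nat \<Rightarrow> (real set \<Rightarrow> real set) \<Rightarrow> (real set \<Rightarrow> 'a::real_vector) \<Rightarrow> real \<Rightarrow> 'a" where
  "haar_comb N \<sigma> a t = (\<Sum>I\<in>dyadic_below N. haar (\<sigma> I) t *\<^sub>R a I)"

definition level_preserving :: "(real set \<Rightarrow> real set) \<Rightarrow> bool" where
  "level_preserving \<tau> \<longleftrightarrow> (\<forall>k. \<forall>I\<in>dyadic_level k. \<tau> I \<in> dyadic_level k)"

lemma level_preservingD: "level_preserving \<tau> \<Longrightarrow> I \<in> dyadic_level k \<Longrightarrow> \<tau> I \<in> dyadic_level k"
  by (simp add: level_preserving_def)

lemma level_preserving_id: "level_preserving id"
  by (simp add: level_preserving_def)

lemma finite_dyadic_level [simp]: "finite (dyadic_level k)"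
proof -
  have "dyadic_level k = (\<lambda>j. {real j / 2 ^ k ..< (real j + 1) / 2 ^ k}) ` {..<2 ^ k}"
    by (auto simp: dyadic_level_def)
  then show ?thesis by simp
qed

lemma finite_dyadic_below [simp]: "finite (dyadic_below N)"
  by (simp add: dyadic_below_def)

lemma dyadic_belowE:
  assumes "I \<in> dyadic_below N"
  obtains k where "k < N" "I \<in> dyadic_level k"
  using assms by (auto simp: dyadic_below_def)

lemma dyadic_belowI: "I \<in> dyadic_level k \<Longrightarrow> k < N \<Longrightarrow> I \<in> dyadic_below N"
  by (auto simp: dyadic_below_def)

lemma dyadic_level_subset_dyadic: "I \<in> dyadic_level k \<Longrightarrow> I \<in> dyadic"
  by (auto simp: dyadic_def)

lemma dyadic_below_subset_dyadic: "dyadic_below N \<subseteq> dyadic"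
  by (auto simp: dyadic_below_def dyadic_def)

lemma finite_dyadic_subset_below:
  assumes "finite S" "S \<subseteq> dyadic"
  shows "\<exists>N. S \<subseteq> dyadic_below N"
  using assms
proof (induction S rule: finite_induct)
  case (insert I S)
  then obtain N k where "S \<subseteq> dyadic_below N" "I \<in> dyadic_level k"
    by (auto simp: dyadic_def)
  then have "insert I S \<subseteq> dyadic_below (max N (Suc k))"
    by (fastforce simp: dyadic_below_def)
  then show ?case by blast
qed simp

lemma level_preserving_if_measure:
  assumes "\<tau> ` dyadic \<subseteq> dyadic" "\<forall>I\<in>dyadic. measure lborel (\<tau> I) = measure lborel I"
  shows "level_preserving \<tau>"
  unfolding level_preserving_def
proof (intro allI ballI)
  fix k I assume I: "I \<in> dyadic_level k"
  then have "I \<in> dyadic" by (rule dyadic_level_subset_dyadic)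
  then have "\<tau> I \<in> dyadic" "measure lborel (\<tau> I) = measure lborel I"
    using assms by blast+
  then show "\<tau> I \<in> dyadic_level k"
    using dyadic_level_unique[OF _ I] by (auto simp: dyadic_def)
qed

lemma haar_sum_eq_haar_comb:
  assumes "dyadic_support a \<subseteq> dyadic_below N"
  shows "haar_sum \<sigma> a = haar_comb N \<sigma> a"
proof
  fix t
  show "haar_sum \<sigma> a t = haar_comb N \<sigma> a t"
    unfolding haar_sum_def haar_comb_def using assms dyadic_below_subset_dyadic[of N]
    by (intro sum.mono_neutral_left) (auto simp: dyadic_support_def)
qed

lemma haar_comb_const:
  assumes "level_preserving \<tau>" "I \<in> dyadic_level N" "s \<in> I" "t \<in> I"
  shows "haar_comb N \<tau> a s = haar_comb N \<tau> a t"
  unfolding haar_comb_def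
proof (intro sum.cong refl arg_cong2[where f = scaleR])
  fix J assume "J \<in> dyadic_below N"
  then obtain k where "k < N" "J \<in> dyadic_level k" by (rule dyadic_belowE)
  then show "haar (\<tau> J) s = haar (\<tau> J) t"
    using haar_const_on_finer level_preservingD[OF assms(1)] assms(2-4) by blast
qed

lemma haar_comb_scale: "haar_comb N \<tau> (\<lambda>I. s *\<^sub>R a I) t = s *\<^sub>R haar_comb N \<tau> a t"
  by (simp add: haar_comb_def scaleR_sum_right mult.commute)

lemma Lp_norm_haar_comb:
  assumes "level_preserving \<tau>"
  shows "Lp_norm p (haar_comb N \<tau> a) =
    ((\<Sum>t\<in>grid N. norm (haar_comb N \<tau> a t) powr p) / 2 ^ N) powr (1 / p)"
  by (intro Lp_norm_eq_grid_sum haar_comb_const[OF assms])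

text \<open>
  Boundedness on the unit ball becomes an inequality between \<open>p\<close>-th powers by homogeneity. When the
  right-hand side vanishes, every multiple of \<open>a\<close> lies in the unit ball, and the left-hand side must
  vanish too.
\<close>

lemma grid_bound_if_rearrangement_bounded:
  fixes \<tau> :: "real set \<Rightarrow> real set"
  assumes "rearrangement_bounded TYPE('a::banach) \<tau> p" "level_preserving \<tau>" "0 < p"
  obtains C where "0 < C" "\<And>N (a :: real set \<Rightarrow> 'a).
    (\<Sum>t\<in>grid N. norm (haar_comb N \<tau> a t) powr p) \<le>
      C * (\<Sum>t\<in>grid N. norm (haar_comb N id a t) powr p)"
proof -
  obtain M where M: "Lp_norm p (haar_sum \<tau> a) \<le> M"
    if "finite (dyadic_support a)" "Lp_norm p (haar_sum id a) \<le> 1" for a :: "real set \<Rightarrow> 'a"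
    using assms(1) unfolding rearrangement_bounded_def bdd_above_def by blast
  \<comment> \<open>The maximum makes \<open>C\<close> positive even when the operator norm is zero.\<close>
  define C where "C = (max M 1) powr p"
  have C0: "0 < C" by (simp add: C_def)
  define P where "P N \<sigma> (a :: real set \<Rightarrow> 'a) =
    (\<Sum>t\<in>grid N. norm (haar_comb N \<sigma> a t) powr p) / 2 ^ N" for N \<sigma> a
  have P0: "0 \<le> P N \<sigma> a" for N \<sigma> a by (simp add: P_def sum_nonneg)
  have bound1: "P N \<tau> a \<le> C" if "P N id a \<le> 1" for N a
  proof -
    define b where "b I = (if I \<in> dyadic_below N then a I else 0)" for I
    have sub: "dyadic_support b \<subseteq> dyadic_below N"
      by (auto simp: dyadic_support_def b_def)
    have eq: "haar_sum \<sigma> b = haar_comb N \<sigma> a" for \<sigma>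
      unfolding haar_sum_eq_haar_comb[OF sub] by (simp add: haar_comb_def b_def fun_eq_iff)
    have "Lp_norm p (haar_sum id b) \<le> 1"
      unfolding eq Lp_norm_haar_comb[OF level_preserving_id] P_def[symmetric]
      using that P0 assms(3) by (simp add: powr_le1)
    then have "Lp_norm p (haar_sum \<tau> b) \<le> M"
      by (intro M finite_subset[OF sub]) simp_all
    then have "P N \<tau> a powr (1 / p) \<le> max M 1"
      unfolding eq Lp_norm_haar_comb[OF assms(2)] P_def[symmetric] by simp
    then have "(P N \<tau> a powr (1 / p)) powr p \<le> C"
      unfolding C_def using assms(3) by (intro powr_mono2) auto
    then show ?thesis using assms(3) P0 by (simp add: powr_powr)
  qed
  have scale: "P N \<sigma> (\<lambda>I. s *\<^sub>R a I) = s powr p * P N \<sigma> a" if "0 \<le> s" for N \<sigma> s a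
    using that by (simp add: P_def haar_comb_scale powr_mult sum_distrib_left)
  have "P N \<tau> a \<le> C * P N id a" for N a
  proof (cases "P N id a = 0")
    case True
    have "s * P N \<tau> a \<le> C" if "0 < s" for s
      using bound1[of N "\<lambda>I. (s powr (1 / p)) *\<^sub>R a I"] that assms(3) True
      by (simp add: scale powr_powr)
    \<comment> \<open>A positive value of \<open>P N \<tau> a\<close> would give \<open>C + 1 \<le> C\<close>.\<close>
    from this[of "(C + 1) / P N \<tau> a"] have "P N \<tau> a = 0"
      using P0[of N \<tau> a] C0 by (cases "P N \<tau> a = 0") auto
    then show ?thesis using True by simp
  next
    case False
    then have pos: "0 < P N id a" using P0[of N id a] by simp
    have "1 / P N id a * P N \<tau> a \<le> C"
      using bound1[of N "\<lambda>I. ((1 / P N id a) powr (1 / p)) *\<^sub>R a I"] pos assms(3)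
      by (simp add: scale powr_powr)
    then show ?thesis using pos by (simp add: field_simps)
  qed
  then show thesis using that[OF C0] by (simp add: P_def field_simps)
qed

lemma rearrangement_bounded_if_grid_bound:
  fixes \<tau> :: "real set \<Rightarrow> real set"
  assumes "level_preserving \<tau>" "0 < q" "0 \<le> K"
    and bound: "\<And>N (a :: real set \<Rightarrow> 'a::banach).
    (\<Sum>t\<in>grid N. norm (haar_comb N \<tau> a t) powr q) \<le>
      K * (\<Sum>t\<in>grid N. norm (haar_comb N id a t) powr q)"
  shows "rearrangement_bounded TYPE('a) \<tau> q"
  unfolding rearrangement_bounded_def
proof (intro bdd_aboveI[where M = "K powr (1 / q)"])
  fix r assume "r \<in> {Lp_norm q (haar_sum \<tau> a) | a :: real set \<Rightarrow> 'a.
       finite (dyadic_support a) \<and> Lp_norm q (haar_sum id a) \<le> 1}"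
  then obtain a :: "real set \<Rightarrow> 'a" where r: "r = Lp_norm q (haar_sum \<tau> a)"
    and fin: "finite (dyadic_support a)" and le: "Lp_norm q (haar_sum id a) \<le> 1" by blast
  obtain N where N: "dyadic_support a \<subseteq> dyadic_below N"
    using finite_dyadic_subset_below[OF fin] by (auto simp: dyadic_support_def)
  define F where "F = (\<Sum>t\<in>grid N. norm (haar_comb N id a t) powr q) / 2 ^ N"
  define H where "H = (\<Sum>t\<in>grid N. norm (haar_comb N \<tau> a t) powr q) / 2 ^ N"
  have nonneg: "0 \<le> F" "0 \<le> H" by (simp_all add: F_def H_def sum_nonneg)
  have "F powr (1 / q) \<le> 1"
    using le unfolding haar_sum_eq_haar_comb[OF N] Lp_norm_haar_comb[OF level_preserving_id] F_def .
  then have "(F powr (1 / q)) powr q \<le> 1"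
    using assms(2) by (intro powr_le1) auto
  then have "F \<le> 1" using assms(2) nonneg by (simp add: powr_powr)
  have "H \<le> K * F" using bound[of N a] by (simp add: F_def H_def divide_right_mono)
  also have "\<dots> \<le> K" using \<open>F \<le> 1\<close> assms(3) by (simp add: mult_left_le)
  finally have "H powr (1 / q) \<le> K powr (1 / q)"
    using nonneg assms(2) by (intro powr_mono2) auto
  then show "r \<le> K powr (1 / q)"
    unfolding r haar_sum_eq_haar_comb[OF N] Lp_norm_haar_comb[OF assms(1)] H_def .
qed

section \<open>Images of the descendants of an interval\<close>

lemma dyadic_maximal_subfamily:
  assumes "finite S" "S \<subseteq> dyadic"
  obtains M where "M \<subseteq> S" "\<And>I. I \<in> S \<Longrightarrow> \<exists>J\<in>M. I \<subseteq> J"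
    "\<And>I J. I \<in> M \<Longrightarrow> J \<in> M \<Longrightarrow> I \<noteq> J \<Longrightarrow> I \<inter> J = {}"
proof -
  define M where "M = {I \<in> S. \<forall>J\<in>S. I \<subseteq> J \<longrightarrow> I = J}"
  have "\<exists>J\<in>M. I \<subseteq> J" if "I \<in> S" for I
    using finite_has_maximal2[OF assms(1) that] unfolding M_def by blast
  moreover have "I \<inter> J = {}" if "I \<in> M" "J \<in> M" "I \<noteq> J" for I J
  proof (rule ccontr)
    assume "I \<inter> J \<noteq> {}"
    then obtain t where t: "t \<in> I" "t \<in> J" by blast
    have "I \<in> dyadic" "J \<in> dyadic" using that assms(2) by (auto simp: M_def)
    then obtain k l where "I \<in> dyadic_level k" "J \<in> dyadic_level l"
      unfolding dyadic_def by blast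
    then have "I \<subseteq> J \<or> J \<subseteq> I"
      using dyadic_level_nested[OF _ _ _ t] dyadic_level_nested[OF _ _ _ t(2,1)]
      by (meson nle_le)
    then show False using that by (auto simp: M_def)
  qed
  moreover have "M \<subseteq> S" by (auto simp: M_def)
  ultimately show thesis using that[of M] by blast
qed

text \<open>
  Distinct intervals of the same level are disjoint. For different levels, the coarser Haar function
  is constant on the support of the finer one, which has mean zero.
\<close>

lemma haar_orthogonal_if_level_le:
  assumes "I \<in> dyadic_level k" "J \<in> dyadic_level l" "k \<le> l" "l < N" "I \<noteq> J"
  shows "(\<Sum>t\<in>grid N. haar I t * haar J t) = 0"
proof (cases "k = l")
  case True
  then have "haar I t = 0 \<or> haar J t = 0" for t
    using assms dyadic_level_eq_cell haar_outside by metis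
  then show ?thesis by (intro sum.neutral) auto
next
  case False
  obtain s where s: "s \<in> J" using dyadic_level_ne[OF assms(2)] by blast
  have "(\<Sum>t\<in>grid N. haar I t * haar J t) = (\<Sum>t\<in>grid N \<inter> J. haar I t * haar J t)"
    by (intro sum.mono_neutral_right) (auto simp: haar_outside[OF assms(2)])
  also have "\<dots> = (\<Sum>t\<in>grid N \<inter> J. haar I s * haar J t)"
    using haar_const_on_finer[OF assms(1) _ assms(2) _ s] False assms(3)
    by (intro sum.cong) auto
  also have "\<dots> = 0"
    using sum_haar_eq_0[OF assms(2,4,2)] by (simp flip: sum_distrib_left)
  finally show ?thesis .
qed

lemma haar_orthogonal:
  assumes "I \<in> dyadic_below N" "J \<in> dyadic_below N"
  shows "(\<Sum>t\<in>grid N. haar I t * haar J t) = (if I = J then real (card (grid N \<inter> I)) else 0)"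
proof (cases "I = J")
  case True
  obtain k where k: "I \<in> dyadic_level k" using assms(1) by (rule dyadic_belowE)
  have "haar I t * haar I t = (if t \<in> I then 1 else 0)" for t
    using haar_outside[OF k] abs_haar_inside[OF k] by (metis abs_mult_self_eq mult_1 mult_zero_left)
  then show ?thesis using True by (simp add: sum.If_cases)
next
  case False
  obtain k l where "I \<in> dyadic_level k" "k < N" "J \<in> dyadic_level l" "l < N"
    using assms by (auto elim!: dyadic_belowE)
  then have "(\<Sum>t\<in>grid N. haar I t * haar J t) = 0"
    using haar_orthogonal_if_level_le[of I k J l N] haar_orthogonal_if_level_le[of J l I k N] False
    by (cases "k \<le> l") (auto simp: mult.commute)
  then show ?thesis using False by simp
qed

lemma haar_sum_square:
  assumes "E \<subseteq> dyadic_below N"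
  shows "(\<Sum>t\<in>grid N. (\<Sum>J\<in>E. haar J t)\<^sup>2) = (\<Sum>J\<in>E. real (card (grid N \<inter> J)))"
proof -
  have fin: "finite E" by (rule finite_subset[OF assms]) simp
  have "(\<Sum>t\<in>grid N. (\<Sum>J\<in>E. haar J t)\<^sup>2)
      = (\<Sum>t\<in>grid N. \<Sum>I\<in>E. \<Sum>J\<in>E. haar I t * haar J t)"
    by (simp add: power2_eq_square sum_product)
  also have "\<dots> = (\<Sum>I\<in>E. \<Sum>J\<in>E. \<Sum>t\<in>grid N. haar I t * haar J t)"
    by (subst sum.swap, intro sum.cong refl, rule sum.swap)
  also have "\<dots> = (\<Sum>I\<in>E. \<Sum>J\<in>E. if I = J then real (card (grid N \<inter> I)) else 0)"
    using assms by (intro sum.cong refl haar_orthogonal) auto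
  also have "\<dots> = (\<Sum>J\<in>E. real (card (grid N \<inter> J)))"
    using fin by simp
  finally show ?thesis .
qed

text \<open>
  A substitute for the embedding of \<open>L\<^sup>2\<close> into \<open>L\<^sup>p\<close> on a set of finite measure: the free threshold
  \<open>s\<close> trades the measure of the set against the square norm.
\<close>

lemma powr_le_square_split:
  fixes y s p :: real
  assumes "0 < s" "0 \<le> y" "1 < p" "p < 2"
  shows "y powr p \<le> s powr p + s powr (p - 2) * y\<^sup>2"
proof (cases "y \<le> s")
  case True
  then have "y powr p \<le> s powr p" using assms by (intro powr_mono2) auto
  then show ?thesis by (simp add: add_increasing2)
next
  case False
  then have "y powr p = y powr (p - 2) * y\<^sup>2"
    using assms by (simp flip: powr_add powr_numeral)
  also have "\<dots> \<le> s powr (p - 2) * y\<^sup>2"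
    using False assms by (intro mult_right_mono powr_mono2') auto
  finally show ?thesis by (simp add: add_increasing)
qed

text \<open>
  Let \<open>E\<close> consist of the \<open>J \<subseteq> I0\<close> whose images are maximal among
  all images, and test the operator on the sum of the \<open>h\<^sub>J\<close>, \<open>J \<in> E\<close>, times a fixed vector. The images are
  disjoint, so the transformed function has constant norm on the union of the images, of measure
  \<open>u\<close> say. By orthogonality the original function has squared \<open>L\<^sup>2\<close> norm equal
  (for a unit vector) to the sum of the \<open>|J|\<close>, which is also \<open>u\<close>, since \<open>|\<tau>(J)| = |J|\<close>; and it lives on \<open>I0\<close>.
  Comparing the two gives \<open>u \<le> C (s\<^sup>p |I0| + s powr (p - 2) u)\<close> for every \<open>s > 0\<close>, and since \<open>p < 2\<close>
  a large \<open>s\<close> lets the last term be absorbed on the left.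
\<close>

lemma card_image_descendants_le:
  fixes \<tau> :: "real set \<Rightarrow> real set" and x :: "'a::banach"
  assumes lp: "level_preserving \<tau>" and inj: "inj_on \<tau> dyadic"
    and p: "1 < p" "p < 2" and C: "0 < C" and x: "x \<noteq> 0"
    and bound: "\<And>a :: real set \<Rightarrow> 'a.
      (\<Sum>t\<in>grid N. norm (haar_comb N \<tau> a t) powr p) \<le>
      C * (\<Sum>t\<in>grid N. norm (haar_comb N id a t) powr p)"
    and I0: "I0 \<in> dyadic_level k"
  shows "real (card (grid N \<inter> \<Union>(\<tau> ` {J \<in> dyadic_below N. J \<subseteq> I0})))
     \<le> 2 * C * (2 * C) powr (p / (2 - p)) * real (card (grid N \<inter> I0))"
proof -
  let ?B = "{J \<in> dyadic_below N. J \<subseteq> I0}"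
  have levelB: "\<exists>l<N. J \<in> dyadic_level l \<and> \<tau> J \<in> dyadic_level l" if "J \<in> ?B" for J
    using that level_preservingD[OF lp] by (auto elim!: dyadic_belowE)
  obtain M where MB: "M \<subseteq> \<tau> ` ?B" and cover: "\<And>I. I \<in> \<tau> ` ?B \<Longrightarrow> \<exists>J\<in>M. I \<subseteq> J"
    and disj: "\<And>I J. I \<in> M \<Longrightarrow> J \<in> M \<Longrightarrow> I \<noteq> J \<Longrightarrow> I \<inter> J = {}"
  proof (rule dyadic_maximal_subfamily[of "\<tau> ` ?B"])
    show "\<tau> ` ?B \<subseteq> dyadic" using levelB dyadic_level_subset_dyadic by blast
  qed auto
  have UnM: "\<Union>M = \<Union>(\<tau> ` ?B)" using MB cover by blast
  define E where "E = {J \<in> ?B. \<tau> J \<in> M}"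
  have EB: "E \<subseteq> ?B" and finE: "finite E" by (auto simp: E_def)
  have ME: "M = \<tau> ` E" using MB by (auto simp: E_def)
  have injE: "inj_on \<tau> E"
    using EB dyadic_below_subset_dyadic by (intro inj_on_subset[OF inj]) auto
  define u where "u = real (card (grid N \<inter> \<Union>M))"
  define m where "m = real (card (grid N \<inter> I0))"
  define y where "y t = \<bar>\<Sum>J\<in>E. haar J t\<bar>" for t
  define a where "a J = (if J \<in> E then x else 0)" for J
  have comb: "haar_comb N \<sigma> a t = (\<Sum>J\<in>E. haar (\<sigma> J) t) *\<^sub>R x" for \<sigma> t
  proof -
    have "haar_comb N \<sigma> a t = (\<Sum>J\<in>E. haar (\<sigma> J) t *\<^sub>R a J)"
      unfolding haar_comb_def using EB by (intro sum.mono_neutral_right) (auto simp: a_def)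
    then show ?thesis by (simp add: a_def scaleR_sum_left)
  qed
  have finM: "finite M" using finE ME by simp
  have levelM: "\<exists>l. K \<in> dyadic_level l" if "K \<in> M" for K
    using that ME EB levelB by blast
  have sumM: "\<bar>\<Sum>K\<in>M. haar K t\<bar> = (if t \<in> \<Union>M then 1 else 0)" for t
  proof (cases "t \<in> \<Union>M")
    case True
    then obtain K where K: "K \<in> M" "t \<in> K" by blast
    have "haar K' t = 0" if "K' \<in> M - {K}" for K'
      using that K disj[of K K'] levelM haar_outside by blast
    then have "(\<Sum>K\<in>M. haar K t) = haar K t"
      using K(1) finM by (subst sum.remove[of M K]) auto
    then show ?thesis using True K levelM abs_haar_inside by metis
  next
    case False
    then have "haar K t = 0" if "K \<in> M" for K
      using that levelM haar_outside by blast
    then show ?thesis using False by simp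
  qed
  have "(\<Sum>J\<in>E. haar (\<tau> J) t) = (\<Sum>K\<in>M. haar K t)" for t
    unfolding ME by (simp add: sum.reindex[OF injE])
  then have "norm (haar_comb N \<tau> a t) powr p = (if t \<in> \<Union>M then norm x powr p else 0)" for t
    by (simp add: comb sumM)
  then have left: "(\<Sum>t\<in>grid N. norm (haar_comb N \<tau> a t) powr p) = u * norm x powr p"
    unfolding u_def by (simp add: sum.If_cases Int_def)
  have right: "(\<Sum>t\<in>grid N. norm (haar_comb N id a t) powr p)
      = (\<Sum>t\<in>grid N. y t powr p) * norm x powr p"
    by (simp add: comb y_def powr_mult sum_distrib_right)
  have main: "u \<le> C * (\<Sum>t\<in>grid N. y t powr p)"
    using bound[of a] x unfolding left right by simp
  have y0: "y t = 0" if "t \<notin> I0" for t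
  proof -
    have "haar J t = 0" if "J \<in> E" for J
      using that \<open>t \<notin> I0\<close> EB levelB haar_outside by blast
    then show ?thesis by (simp add: y_def)
  qed
  have square: "(\<Sum>t\<in>grid N. (y t)\<^sup>2) = u"
  proof -
    have "(\<Sum>t\<in>grid N. (y t)\<^sup>2) = (\<Sum>J\<in>E. real (card (grid N \<inter> J)))"
      unfolding y_def power2_abs using EB by (intro haar_sum_square) auto
    also have "\<dots> = (\<Sum>J\<in>E. real (card (grid N \<inter> \<tau> J)))"
    proof (intro sum.cong refl arg_cong[where f = real])
      fix J assume "J \<in> E"
      then obtain l where "l < N" "J \<in> dyadic_level l" "\<tau> J \<in> dyadic_level l"
        using EB levelB by blast
      then show "card (grid N \<inter> J) = card (grid N \<inter> \<tau> J)"
        by (simp add: card_grid_dyadic_level)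
    qed
    also have "\<dots> = (\<Sum>K\<in>M. real (card (grid N \<inter> K)))"
      unfolding ME by (simp add: sum.reindex[OF injE])
    also have "\<dots> = real (card (\<Union>K\<in>M. grid N \<inter> K))"
      using disj finM by (subst card_UN_disjoint) auto
    also have "(\<Union>K\<in>M. grid N \<inter> K) = grid N \<inter> \<Union>M" by blast
    finally show ?thesis unfolding u_def .
  qed
  \<comment> \<open>The threshold for which \<open>C * s powr (p - 2) = 1 / 2\<close>, so that half of \<open>u\<close> is absorbed.\<close>
  define s where "s = (2 * C) powr (1 / (2 - p))"
  have s: "0 < s" using C by (simp add: s_def)
  have sp: "s powr p = (2 * C) powr (p / (2 - p))" by (simp add: s_def powr_powr)
  have "(p - 2) / (2 - p) = -1" using p by (simp add: field_simps)
  then have "s powr (p - 2) = 1 / (2 * C)"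
    using C by (simp add: s_def powr_powr powr_minus_divide)
  then have half: "C * (s powr (p - 2) * u) = u / 2" using C by simp
  have "(\<Sum>t\<in>grid N. y t powr p) = (\<Sum>t\<in>grid N \<inter> I0. y t powr p)"
    using y0 by (intro sum.mono_neutral_right) auto
  also have "\<dots> \<le> (\<Sum>t\<in>grid N \<inter> I0. s powr p + s powr (p - 2) * (y t)\<^sup>2)"
    using s p by (intro sum_mono powr_le_square_split) (auto simp: y_def)
  also have "\<dots> = m * s powr p + s powr (p - 2) * (\<Sum>t\<in>grid N \<inter> I0. (y t)\<^sup>2)"
    by (simp add: sum.distrib sum_distrib_left m_def)
  also have "(\<Sum>t\<in>grid N \<inter> I0. (y t)\<^sup>2) = u"
    unfolding square[symmetric] using y0 by (intro sum.mono_neutral_left) auto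
  finally have "C * (\<Sum>t\<in>grid N. y t powr p) \<le> C * (m * s powr p + s powr (p - 2) * u)"
    using C by (intro mult_left_mono) auto
  with main have "u \<le> C * (m * s powr p) + C * (s powr (p - 2) * u)"
    by (simp add: distrib_left)
  then have "u \<le> C * (m * s powr p) + u / 2" unfolding half .
  moreover have "2 * C * s powr p * m = 2 * (C * (m * s powr p))" by simp
  ultimately have "u \<le> 2 * C * s powr p * m" by linarith
  then show ?thesis unfolding u_def m_def sp UnM .
qed

section \<open>Marcinkiewicz interpolation on a finite set\<close>

lemma has_integral_powr_initial:
  fixes q y :: real
  assumes "0 < q" "0 \<le> y"
  shows "((\<lambda>l. if l \<le> y then q * l powr (q - 1) else 0) has_integral y powr q) {0..}"
proof -
  have "((\<lambda>l. q * l powr (q - 1)) has_integral q * (y powr (q - 1 + 1) / (q - 1 + 1))) {0..y}"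
    using assms by (intro has_integral_mult_right has_integral_powr_from_0) auto
  then have "((\<lambda>l. if l \<in> {0..y} then q * l powr (q - 1) else 0) has_integral y powr q) {0..}"
    using assms by (subst has_integral_restrict) auto
  then show ?thesis by (rule has_integral_eq[rotated]) auto
qed

lemma has_integral_powr_final:
  fixes r w :: real
  assumes "0 < r" "0 < w"
  shows "((\<lambda>l. if w \<le> l then l powr (- r - 1) else 0) has_integral w powr (- r) / r) {0..}"
proof -
  have "((\<lambda>l. l powr (- r - 1)) has_integral - (w powr (- r - 1 + 1)) / (- r - 1 + 1)) {w..}"
    using assms by (intro has_integral_powr_to_inf) auto
  then have "((\<lambda>l. if l \<in> {w..} then l powr (- r - 1) else 0) has_integral w powr (- r) / r) {0..}"
    using assms by (subst has_integral_restrict) auto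
  then show ?thesis by (rule has_integral_eq[rotated]) auto
qed

text \<open>
  The layer cake argument: multiply the distributional inequality by \<open>q l powr (q - 1)\<close> and
  integrate over \<open>l \<ge> 0\<close>. The first term on the right is integrable at \<open>0\<close> because \<open>q > 1\<close>, the
  second one at infinity because \<open>q < p\<close>. Restricting the sums to the large and to the small values of \<open>w\<close>
  is what makes both integrals converge; the factor \<open>2\<close> in \<open>l < 2 * w t\<close> comes from the
  Calderon--Zygmund decomposition.
\<close>

lemma discrete_marcinkiewicz:
  fixes y w :: "'i \<Rightarrow> real" and p q A B :: real
  assumes fin: "finite G" and q: "1 < q" "q < p"
    and nonneg: "\<And>t. t \<in> G \<Longrightarrow> 0 \<le> y t" "\<And>t. t \<in> G \<Longrightarrow> 0 \<le> w t"
    and weak: "\<And>l. 0 < l \<Longrightarrow> real (card {t \<in> G. l \<le> y t}) \<le>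
      A / l * (\<Sum>t | t \<in> G \<and> l < 2 * w t. w t) + B / l powr p * (\<Sum>t | t \<in> G \<and> w t \<le> l. w t powr p)"
    and AB: "0 \<le> A" "0 \<le> B"
  shows "(\<Sum>t\<in>G. y t powr q) \<le>
    (A * q * 2 powr (q - 1) / (q - 1) + B * q / (p - q)) * (\<Sum>t\<in>G. w t powr q)"
proof -
  define L where "L l = (\<Sum>t\<in>G. if l \<le> y t then q * l powr (q - 1) else 0)" for l
  \<comment> \<open>\<open>R1\<close> and \<open>R2\<close> are the contributions of \<open>t\<close> to the two terms on the right, normalised so that
      the integrals of powers apply verbatim. The point \<open>w t = 0\<close> is excluded from \<open>R2\<close>, where the
      power of \<open>l\<close> would not be integrable at \<open>0\<close>.\<close>
  define R1 where "R1 l t = A * q / (q - 1) * w t * (if l \<le> 2 * w t then (q - 1) * l powr (q - 1 - 1) else 0)" for l t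
  define R2 where "R2 l t = B * q * w t powr p * (if 0 < w t \<and> w t \<le> l then l powr (- (p - q) - 1) else 0)" for l t
  have intL: "(L has_integral (\<Sum>t\<in>G. y t powr q)) {0..}"
    unfolding L_def using fin q nonneg
    by (intro has_integral_sum has_integral_powr_initial) auto
  have int1: "((\<lambda>l. R1 l t) has_integral A * q / (q - 1) * w t * (2 * w t) powr (q - 1)) {0..}"
    if "t \<in> G" for t
    unfolding R1_def using that q nonneg
    by (intro has_integral_mult_right has_integral_powr_initial) auto
  have int2: "((\<lambda>l. R2 l t) has_integral B * q * w t powr p * (w t powr (- (p - q)) / (p - q))) {0..}"
    if "t \<in> G" for t
  proof (cases "0 < w t")
    case True
    then show ?thesis unfolding R2_def using q
      by (simp only: simp_thms, intro has_integral_mult_right has_integral_powr_final) auto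
  next
    case False
    then show ?thesis unfolding R2_def using nonneg(2)[OF that] by simp
  qed
  have val1: "A * q / (q - 1) * w t * (2 * w t) powr (q - 1)
      = A * q * 2 powr (q - 1) / (q - 1) * w t powr q" if "t \<in> G" for t
  proof -
    have "w t * w t powr (q - 1) = w t powr q"
      using nonneg(2)[OF that] by (cases "w t = 0") (auto simp: powr_mult_base)
    then show ?thesis using nonneg(2)[OF that] by (simp add: powr_mult mult_ac)
  qed
  have val2: "B * q * w t powr p * (w t powr (- (p - q)) / (p - q)) = B * q / (p - q) * w t powr q"
    for t by (simp flip: powr_add)
  have intR: "((\<lambda>l. \<Sum>t\<in>G. R1 l t + R2 l t) has_integral
      (\<Sum>t\<in>G. A * q * 2 powr (q - 1) / (q - 1) * w t powr q + B * q / (p - q) * w t powr q)) {0..}"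
  proof (intro has_integral_sum fin)
    fix t assume t: "t \<in> G"
    show "((\<lambda>l. R1 l t + R2 l t) has_integral
        A * q * 2 powr (q - 1) / (q - 1) * w t powr q + B * q / (p - q) * w t powr q) {0..}"
      using has_integral_add[OF int1[OF t] int2[OF t]] unfolding val1[OF t] val2 .
  qed
  have le: "L l \<le> (\<Sum>t\<in>G. R1 l t + R2 l t)" if "l \<in> {0..}" for l
  proof (cases "l = 0")
    case True
    then show ?thesis using nonneg AB q by (auto simp: L_def R1_def R2_def intro!: sum_nonneg)
  next
    case False
    then have l: "0 < l" using that by simp
    have p1: "1 / l * l powr (q - 1) = l powr (q - 1 - 1)"
      using l by (simp add: powr_diff power2_eq_square)
    have p2: "1 / l powr p * l powr (q - 1) = l powr (- (p - q) - 1)"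
      using l by (simp add: powr_diff powr_minus_divide)
    have "L l = q * l powr (q - 1) * real (card {t \<in> G. l \<le> y t})"
      unfolding L_def using fin by (simp add: sum.If_cases Int_def)
    also have "\<dots> \<le> q * l powr (q - 1) * (A / l * (\<Sum>t | t \<in> G \<and> l < 2 * w t. w t)
        + B / l powr p * (\<Sum>t | t \<in> G \<and> w t \<le> l. w t powr p))"
      using weak[OF l] q by (intro mult_left_mono) auto
    also have "\<dots> = A * q * (1 / l * l powr (q - 1)) * (\<Sum>t | t \<in> G \<and> l < 2 * w t. w t)
        + B * q * (1 / l powr p * l powr (q - 1)) * (\<Sum>t | t \<in> G \<and> w t \<le> l. w t powr p)"
      by (simp add: algebra_simps)
    also have "\<dots> = (\<Sum>t\<in>G. if l < 2 * w t then A * q * l powr (q - 1 - 1) * w t else 0)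
        + (\<Sum>t\<in>G. if w t \<le> l then B * q * l powr (- (p - q) - 1) * w t powr p else 0)"
      unfolding p1 p2 using fin by (simp add: sum.If_cases Int_def sum_distrib_left)
    also have "\<dots> \<le> (\<Sum>t\<in>G. R1 l t) + (\<Sum>t\<in>G. R2 l t)"
    proof (intro add_mono sum_mono)
      fix t assume t: "t \<in> G"
      show "(if l < 2 * w t then A * q * l powr (q - 1 - 1) * w t else 0) \<le> R1 l t"
        using AB q nonneg(2)[OF t] by (auto simp: R1_def)
      show "(if w t \<le> l then B * q * l powr (- (p - q) - 1) * w t powr p else 0) \<le> R2 l t"
        using nonneg(2)[OF t] by (cases "w t = 0") (auto simp: R2_def)
    qed
    finally show ?thesis by (simp add: sum.distrib)
  qed
  have "(\<Sum>t\<in>G. y t powr q) \<le>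
      (\<Sum>t\<in>G. A * q * 2 powr (q - 1) / (q - 1) * w t powr q + B * q / (p - q) * w t powr q)"
    by (rule has_integral_le[OF intL intR le])
  then show ?thesis by (simp add: sum.distrib sum_distrib_left distrib_right)
qed

section \<open>Calderon--Zygmund decomposition and the weak type estimate\<close>

text \<open>
  Truncating a Haar sum to the levels below \<open>k\<close> is averaging over the dyadic intervals of level \<open>k\<close>:
  finer Haar functions have mean zero on such an interval, and coarser ones are constant there.
\<close>

lemma grid_sum_haar_comb:
  assumes "I \<in> dyadic_level k" "k \<le> N" "t \<in> I"
  shows "(\<Sum>s\<in>grid N \<inter> I. haar_comb N id a s) = real (card (grid N \<inter> I)) *\<^sub>R haar_comb k id a t"
proof -
  have sub: "dyadic_below k \<subseteq> dyadic_below N" using assms(2) by (force simp: dyadic_below_def)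
  have "(\<Sum>s\<in>grid N \<inter> I. haar_comb N id a s)
      = (\<Sum>J\<in>dyadic_below N. (\<Sum>s\<in>grid N \<inter> I. haar J s) *\<^sub>R a J)"
    unfolding haar_comb_def by (subst sum.swap) (simp add: scaleR_sum_left)
  also have "\<dots> = (\<Sum>J\<in>dyadic_below k. (\<Sum>s\<in>grid N \<inter> I. haar J s) *\<^sub>R a J)"
  proof (intro sum.mono_neutral_right sub ballI)
    fix J assume J: "J \<in> dyadic_below N - dyadic_below k"
    then obtain l where l: "l < N" "J \<in> dyadic_level l" by (auto elim: dyadic_belowE)
    then have "k \<le> l" using J dyadic_belowI[of J l k] by (meson DiffD2 not_le)
    then show "(\<Sum>s\<in>grid N \<inter> I. haar J s) *\<^sub>R a J = 0"
      using sum_haar_eq_0[OF l(2,1) assms(1)] by simp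
  qed simp
  also have "\<dots> = (\<Sum>J\<in>dyadic_below k. (real (card (grid N \<inter> I)) * haar J t) *\<^sub>R a J)"
  proof (intro sum.cong refl arg_cong2[where f = scaleR])
    fix J assume "J \<in> dyadic_below k"
    then obtain l where l: "l < k" "J \<in> dyadic_level l" by (rule dyadic_belowE)
    have "(\<Sum>s\<in>grid N \<inter> I. haar J s) = (\<Sum>s\<in>grid N \<inter> I. haar J t)"
      using haar_const_on_finer[OF l(2,1) assms(1) _ assms(3)] by (intro sum.cong) auto
    then show "(\<Sum>s\<in>grid N \<inter> I. haar J s) = real (card (grid N \<inter> I)) * haar J t" by simp
  qed
  finally show ?thesis by (simp add: haar_comb_def scaleR_sum_right)
qed

lemma haar_comb_add:
  "haar_comb N \<sigma> (\<lambda>I. a I + b I) t = haar_comb N \<sigma> a t + haar_comb N \<sigma> b t"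
  by (simp add: haar_comb_def scaleR_add_right sum.distrib)

text \<open>
  The bad intervals are those on which the average of the norm \<open>w\<close> of the function exceeds \<open>l\<close>, and
  \<open>M\<close> consists of the maximal ones. The bad part \<open>b\<close> takes the coefficients of all intervals inside a
  bad one, so the good part \<open>g\<close> is the function stopped on entering a bad interval. Off the bad
  set \<open>g\<close> is the function itself, bounded by \<open>l\<close>; on a maximal bad interval it is the average over
  that interval, which is at most twice the average of \<open>w\<close> over the parent, hence at most \<open>2 l\<close>.

  The bound on the size of the bad set involves only the large values of \<open>w\<close>: values
  up to \<open>l / 2\<close> contribute at most half of an average that exceeds \<open>l\<close>.
\<close>

lemma calderon_zygmund:
  fixes a :: "real set \<Rightarrow> 'a::real_normed_vector" and l p :: real and N :: nat
  defines "w \<equiv> \<lambda>t. norm (haar_comb N id a t)"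
  assumes l: "0 < l" and p: "0 < p"
  obtains M b g where "finite M" "M \<subseteq> dyadic"
    "\<forall>J. a J = g J + b J" "\<forall>J. b J \<noteq> 0 \<longrightarrow> (\<exists>I\<in>M. J \<subseteq> I)"
    "l * (\<Sum>I\<in>M. real (card (grid N \<inter> I))) \<le> 2 * (\<Sum>t | t \<in> grid N \<and> l < 2 * w t. w t)"
    "(\<Sum>t\<in>grid N. norm (haar_comb N id g t) powr p) \<le>
      (\<Sum>t | t \<in> grid N \<and> w t \<le> l. w t powr p) + (2 * l) powr p * (\<Sum>I\<in>M. real (card (grid N \<inter> I)))"
proof -
  define S where "S = {I \<in> dyadic_below (Suc N). l * real (card (grid N \<inter> I)) < (\<Sum>t\<in>grid N \<inter> I. w t)}"
  have S: "S \<subseteq> dyadic_below (Suc N)" and "finite S" by (auto simp: S_def)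
  have Sdy: "S \<subseteq> dyadic" using S dyadic_below_subset_dyadic by blast
  obtain M where MS: "M \<subseteq> S" and cover: "\<And>I. I \<in> S \<Longrightarrow> \<exists>J\<in>M. I \<subseteq> J"
    and disj: "\<And>I J. I \<in> M \<Longrightarrow> J \<in> M \<Longrightarrow> I \<noteq> J \<Longrightarrow> I \<inter> J = {}"
    using dyadic_maximal_subfamily[OF \<open>finite S\<close> Sdy] by metis
  have finM: "finite M" using MS \<open>finite S\<close> by (rule finite_subset)
  have UnM: "\<Union>M = \<Union>S" using MS cover by blast
  define b where "b J = (if \<exists>I\<in>S. J \<subseteq> I then a J else 0)" for J
  define g where "g J = (if \<exists>I\<in>S. J \<subseteq> I then 0 else a J)" for J
  define \<omega> where "\<omega> = (\<Sum>I\<in>M. real (card (grid N \<inter> I)))"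
  have w0: "0 \<le> w t" for t by (simp add: w_def)
  have \<omega>: "\<omega> = real (card (grid N \<inter> \<Union>S))"
  proof -
    have "\<omega> = real (card (\<Union>I\<in>M. grid N \<inter> I))"
      unfolding \<omega>_def using disj finM by (subst card_UN_disjoint) auto
    also have "(\<Union>I\<in>M. grid N \<inter> I) = grid N \<inter> \<Union>S" using UnM by blast
    finally show ?thesis .
  qed
  have size: "l * \<omega> \<le> 2 * (\<Sum>t | t \<in> grid N \<and> l < 2 * w t. w t)"
  proof -
    define v where "v t = (if l < 2 * w t then w t else 0)" for t
    have "l * real (card (grid N \<inter> I)) \<le> 2 * (\<Sum>t\<in>grid N \<inter> I. v t)" if "I \<in> M" for I
    proof -
      have "l * real (card (grid N \<inter> I)) < (\<Sum>t\<in>grid N \<inter> I. w t)"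
        using that MS by (auto simp: S_def)
      also have "\<dots> \<le> (\<Sum>t\<in>grid N \<inter> I. v t + l / 2)"
        using l by (intro sum_mono) (auto simp: v_def)
      also have "\<dots> = (\<Sum>t\<in>grid N \<inter> I. v t) + l * real (card (grid N \<inter> I)) / 2"
        by (simp add: sum.distrib)
      finally show ?thesis by linarith
    qed
    then have "(\<Sum>I\<in>M. l * real (card (grid N \<inter> I))) \<le> (\<Sum>I\<in>M. 2 * (\<Sum>t\<in>grid N \<inter> I. v t))"
      by (rule sum_mono)
    also have "\<dots> = 2 * (\<Sum>t\<in>(\<Union>I\<in>M. grid N \<inter> I). v t)"
      using finM disj by (subst sum.UNION_disjoint) (auto simp: sum_distrib_left)
    also have "\<dots> \<le> 2 * (\<Sum>t\<in>grid N. v t)"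
      using w0 by (intro mult_left_mono sum_mono2) (auto simp: v_def)
    also have "(\<Sum>t\<in>grid N. v t) = (\<Sum>t | t \<in> grid N \<and> l < 2 * w t. w t)"
      by (simp add: v_def sum.If_cases Int_def)
    finally show ?thesis by (simp add: \<omega>_def sum_distrib_left)
  qed
  have outside: "norm (haar_comb N id g t) = w t \<and> w t \<le> l"
    if t: "t \<in> grid N" "t \<notin> \<Union>S" for t
  proof
    have "haar J t *\<^sub>R g J = haar J t *\<^sub>R a J" if "J \<in> dyadic_below N" for J
    proof (cases "t \<in> J")
      case True
      then have "g J = a J" using t(2) by (auto simp: g_def)
      then show ?thesis by simp
    next
      case False
      then show ?thesis using that by (auto elim!: dyadic_belowE simp: haar_outside)
    qed
    then have "haar_comb N id g t = haar_comb N id a t"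
      unfolding haar_comb_def id_apply by (rule sum.cong[OF refl])
    then show "norm (haar_comb N id g t) = w t" by (simp add: w_def)
    have tu: "t \<in> {0..<1}" using t(1) grid_subset_unit by blast
    then have c: "cell N t \<in> dyadic_level N" by (rule cell_in_level)
    have "card (grid N \<inter> cell N t) = 1" using card_grid_dyadic_level[OF c] by simp
    moreover have "t \<in> grid N \<inter> cell N t" using t(1) mem_cell_self by blast
    ultimately have sing: "grid N \<inter> cell N t = {t}" by (metis card_1_singletonE singletonD)
    have "cell N t \<notin> S" using t(2) mem_cell_self by blast
    then show "w t \<le> l" using dyadic_belowI[OF c, of "Suc N"] by (simp add: S_def sing)
  qed
  have inside: "norm (haar_comb N id g t) \<le> 2 * l" if t: "t \<in> grid N" "t \<in> \<Union>S" for t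
  proof -
    have tu: "t \<in> {0..<1}" using t(1) grid_subset_unit by blast
    have cellS: "\<exists>i\<le>N. I \<in> dyadic_level i \<and> I = cell i t" if "I \<in> S" "t \<in> I" for I
    proof -
      have "I \<in> dyadic_below (Suc N)" using that S by blast
      then obtain i where "i < Suc N" "I \<in> dyadic_level i" by (rule dyadic_belowE)
      then show ?thesis using dyadic_level_eq_cell[OF _ that(2)] by (intro exI[of _ i]) auto
    qed
    \<comment> \<open>The stopping level: the cell of level \<open>k\<close> around \<open>t\<close> is the largest bad interval containing \<open>t\<close>.\<close>
    define k where "k = (LEAST k. cell k t \<in> S)"
    obtain I i where "I \<in> S" "I = cell i t" "i \<le> N" using t(2) cellS by blast
    then have kS: "cell k t \<in> S" and kN: "k \<le> N"
      using LeastI[of "\<lambda>k. cell k t \<in> S" i] Least_le[of "\<lambda>k. cell k t \<in> S" i]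
      by (auto simp: k_def)
    have least: "k \<le> i" if "cell i t \<in> S" for i
      unfolding k_def using that by (rule Least_le)
    have term_eq: "haar J t *\<^sub>R g J = (if J \<in> dyadic_below k then haar J t *\<^sub>R a J else 0)"
      if "J \<in> dyadic_below N" for J
    proof -
      obtain j where j: "J \<in> dyadic_level j" using \<open>J \<in> dyadic_below N\<close> by (rule dyadic_belowE)
      consider "t \<notin> J" | "t \<in> J" "j < k" | "t \<in> J" "k \<le> j" by linarith
      then show ?thesis
      proof cases
        case 1
        then show ?thesis using haar_outside[OF j] by simp
      next
        case 2
        have "\<not> J \<subseteq> I" if "I \<in> S" for I
        proof
          assume "J \<subseteq> I"
          then obtain i where i: "I \<in> dyadic_level i" "I = cell i t"
            using cellS[OF \<open>I \<in> S\<close>] 2(1) by blast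
          then have "j < i" using least \<open>I \<in> S\<close> 2(2) by fastforce
          then have "I \<subseteq> J" using dyadic_level_nested[OF j i(1) _ 2(1)] 2(1) \<open>J \<subseteq> I\<close> by auto
          then show False using dyadic_level_unique[OF j i(1)] \<open>J \<subseteq> I\<close> \<open>j < i\<close> by auto
        qed
        then have "g J = a J" by (auto simp: g_def)
        then show ?thesis using dyadic_belowI[OF j 2(2)] by simp
      next
        case 3
        have "J \<subseteq> cell k t"
          using dyadic_level_nested[OF cell_in_level[OF tu] j 3(2) mem_cell_self 3(1)] .
        then have "g J = 0" using kS by (auto simp: g_def)
        moreover have "J \<notin> dyadic_below k"
          using dyadic_level_unique[OF j] 3(2) by (auto elim!: dyadic_belowE)
        ultimately show ?thesis by simp
      qed
    qed
    have "dyadic_below k \<subseteq> dyadic_below N" using kN by (force simp: dyadic_below_def)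
    then have comb: "haar_comb N id g t = haar_comb k id a t"
      by (simp add: haar_comb_def term_eq sum.If_cases Int_absorb1)
    show ?thesis
    proof (cases k)
      case 0
      \<comment> \<open>The whole interval is bad; it has no parent, but a Haar sum has mean zero.\<close>
      then show ?thesis unfolding comb using l by (simp add: haar_comb_def dyadic_below_def)
    next
      case (Suc m)
      let ?c = "real (card (grid N \<inter> cell k t))"
      have ck: "cell k t \<in> dyadic_level k" and cm: "cell m t \<in> dyadic_level m"
        using cell_in_level[OF tu] by auto
      have c: "0 < ?c" using card_grid_dyadic_level[OF ck kN] by simp
      have "N - m = Suc (N - k)" using Suc kN by simp
      moreover have "card (grid N \<inter> cell k t) = 2 ^ (N - k)" "card (grid N \<inter> cell m t) = 2 ^ (N - m)"
        using card_grid_dyadic_level[OF ck kN] card_grid_dyadic_level[OF cm, of N] Suc kN by auto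
      ultimately have double: "real (card (grid N \<inter> cell m t)) = 2 * ?c" by simp
      have "?c * norm (haar_comb k id a t) = norm (\<Sum>s\<in>grid N \<inter> cell k t. haar_comb N id a s)"
        unfolding grid_sum_haar_comb[OF ck kN mem_cell_self] by simp
      also have "\<dots> \<le> (\<Sum>s\<in>grid N \<inter> cell k t. w s)"
        unfolding w_def by (rule norm_sum)
      also have "\<dots> \<le> (\<Sum>s\<in>grid N \<inter> cell m t. w s)"
        using w0 dyadic_level_nested[OF cm ck _ mem_cell_self mem_cell_self] Suc
        by (intro sum_mono2) auto
      also have "\<dots> \<le> l * real (card (grid N \<inter> cell m t))"
      proof -
        have "cell m t \<notin> S" using least[of m] Suc by auto
        then show ?thesis using dyadic_belowI[OF cm, of "Suc N"] Suc kN by (auto simp: S_def)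
      qed
      finally have "?c * norm (haar_comb k id a t) \<le> ?c * (2 * l)"
        unfolding double by (simp add: mult_ac)
      then show ?thesis unfolding comb using c by simp
    qed
  qed
  have "(\<Sum>t\<in>grid N. norm (haar_comb N id g t) powr p)
      \<le> (\<Sum>t\<in>grid N. (if w t \<le> l then w t powr p else 0) + (if t \<in> \<Union>S then (2 * l) powr p else 0))"
  proof (rule sum_mono)
    fix t assume t: "t \<in> grid N"
    show "norm (haar_comb N id g t) powr p
      \<le> (if w t \<le> l then w t powr p else 0) + (if t \<in> \<Union>S then (2 * l) powr p else 0)"
    proof (cases "t \<in> \<Union>S")
      case True
      then have "norm (haar_comb N id g t) powr p \<le> (2 * l) powr p"
        using inside[OF t] p by (intro powr_mono2) auto
      then show ?thesis using True by (auto intro: add_increasing)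
    next
      case False
      then show ?thesis using outside[OF t] by auto
    qed
  qed
  also have "\<dots> = (\<Sum>t | t \<in> grid N \<and> w t \<le> l. w t powr p) + (2 * l) powr p * \<omega>"
    unfolding \<omega> by (simp only: sum.distrib) (simp add: sum.If_cases Int_def mult.commute)
  finally have good: "(\<Sum>t\<in>grid N. norm (haar_comb N id g t) powr p)
      \<le> (\<Sum>t | t \<in> grid N \<and> w t \<le> l. w t powr p) + (2 * l) powr p * \<omega>" .
  have "\<exists>I\<in>M. J \<subseteq> I" if "b J \<noteq> 0" for J
    using that cover unfolding b_def by (meson order_trans)
  moreover have "a J = g J + b J" for J by (simp add: g_def b_def)
  ultimately show thesis
    using finM MS Sdy size good unfolding \<omega>_def by (intro that[of M g b]) auto
qed

text \<open>
  The image of the bad part is supported in the images of the intervals contained in some maximal bad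
  interval, so its support is small by the hypothesis \<open>image\<close>, whatever its values are. The image of
  the good part is controlled by Chebyshev's inequality and the bound for \<open>p\<close>.
\<close>

lemma weak_type_estimate:
  fixes \<tau> :: "real set \<Rightarrow> real set" and a :: "real set \<Rightarrow> 'a::real_normed_vector"
    and A C l p :: real and N :: nat
  defines "w \<equiv> \<lambda>t. norm (haar_comb N id a t)" and "y \<equiv> \<lambda>t. norm (haar_comb N \<tau> a t)"
  assumes lp: "level_preserving \<tau>" and p: "0 < p" and C: "0 \<le> C" and A: "0 \<le> A"
    and bound: "\<And>a :: real set \<Rightarrow> 'a.
      (\<Sum>t\<in>grid N. norm (haar_comb N \<tau> a t) powr p) \<le>
      C * (\<Sum>t\<in>grid N. norm (haar_comb N id a t) powr p)"
    and image: "\<And>I. I \<in> dyadic \<Longrightarrow>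
      real (card (grid N \<inter> \<Union>(\<tau> ` {J \<in> dyadic_below N. J \<subseteq> I}))) \<le> A * real (card (grid N \<inter> I))"
    and l: "0 < l"
  shows "real (card {t \<in> grid N. l \<le> y t}) \<le>
    2 * (A + C * 2 powr p) / l * (\<Sum>t | t \<in> grid N \<and> l < 2 * w t. w t)
     + C / l powr p * (\<Sum>t | t \<in> grid N \<and> w t \<le> l. w t powr p)"
proof -
  obtain M b g where M: "finite M" "M \<subseteq> dyadic"
    and a: "\<forall>J. a J = g J + b J" and b: "\<forall>J. b J \<noteq> 0 \<longrightarrow> (\<exists>I\<in>M. J \<subseteq> I)"
    and size: "l * (\<Sum>I\<in>M. real (card (grid N \<inter> I))) \<le> 2 * (\<Sum>t | t \<in> grid N \<and> l < 2 * w t. w t)"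
    and good: "(\<Sum>t\<in>grid N. norm (haar_comb N id g t) powr p) \<le>
      (\<Sum>t | t \<in> grid N \<and> w t \<le> l. w t powr p) + (2 * l) powr p * (\<Sum>I\<in>M. real (card (grid N \<inter> I)))"
    unfolding w_def by (rule calderon_zygmund[OF l p, of a N])
  define \<omega> where "\<omega> = (\<Sum>I\<in>M. real (card (grid N \<inter> I)))"
  define W where "W = (\<Sum>t | t \<in> grid N \<and> w t \<le> l. w t powr p)"
  let ?D = "\<lambda>I. {J \<in> dyadic_below N. J \<subseteq> I}"
  let ?X = "{t \<in> grid N. haar_comb N \<tau> b t \<noteq> 0}" and ?Y = "{t \<in> grid N. l \<le> norm (haar_comb N \<tau> g t)}"
  have "?X \<subseteq> (\<Union>I\<in>M. grid N \<inter> \<Union>(\<tau> ` ?D I))"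
  proof
    fix t assume t: "t \<in> ?X"
    then obtain J where J: "J \<in> dyadic_below N" "haar (\<tau> J) t *\<^sub>R b J \<noteq> 0"
      unfolding haar_comb_def by (auto elim: sum.not_neutral_contains_not_neutral)
    obtain k where "J \<in> dyadic_level k" using J(1) by (rule dyadic_belowE)
    then have "t \<in> \<tau> J" using J(2) haar_outside[OF level_preservingD[OF lp]] by auto
    moreover obtain I where "I \<in> M" "J \<subseteq> I" using b J(2) by fastforce
    ultimately show "t \<in> (\<Union>I\<in>M. grid N \<inter> \<Union>(\<tau> ` ?D I))" using t J(1) by blast
  qed
  then have "card ?X \<le> card (\<Union>I\<in>M. grid N \<inter> \<Union>(\<tau> ` ?D I))"
    using M(1) by (intro card_mono) auto
  also have "\<dots> \<le> (\<Sum>I\<in>M. card (grid N \<inter> \<Union>(\<tau> ` ?D I)))"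
    using M(1) by (rule card_UN_le)
  finally have "real (card ?X) \<le> (\<Sum>I\<in>M. real (card (grid N \<inter> \<Union>(\<tau> ` ?D I))))"
    by (simp flip: of_nat_sum)
  also have "\<dots> \<le> (\<Sum>I\<in>M. A * real (card (grid N \<inter> I)))"
    using M(2) by (intro sum_mono image) auto
  finally have X: "real (card ?X) \<le> A * \<omega>" by (simp add: \<omega>_def sum_distrib_left)
  have "l powr p * real (card ?Y) = (\<Sum>t\<in>?Y. l powr p)" by simp
  also have "\<dots> \<le> (\<Sum>t\<in>?Y. norm (haar_comb N \<tau> g t) powr p)"
    using l p by (intro sum_mono powr_mono2) auto
  also have "\<dots> \<le> (\<Sum>t\<in>grid N. norm (haar_comb N \<tau> g t) powr p)"
    by (intro sum_mono2) auto
  also have "\<dots> \<le> C * (\<Sum>t\<in>grid N. norm (haar_comb N id g t) powr p)" by (rule bound)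
  also have "\<dots> \<le> C * (W + (2 * l) powr p * \<omega>)"
    using good C unfolding W_def \<omega>_def by (intro mult_left_mono)
  finally have "real (card ?Y) \<le> C * (W + (2 * l) powr p * \<omega>) / l powr p"
    using l by (simp add: pos_le_divide_eq mult.commute)
  also have "\<dots> = C / l powr p * W + C * 2 powr p * \<omega>"
    using l by (simp add: powr_mult field_simps)
  finally have Y: "real (card ?Y) \<le> C / l powr p * W + C * 2 powr p * \<omega>" .
  have "a = (\<lambda>J. g J + b J)" using a by auto
  then have "y t = norm (haar_comb N \<tau> g t + haar_comb N \<tau> b t)" for t
    by (simp only: y_def haar_comb_add)
  then have "{t \<in> grid N. l \<le> y t} \<subseteq> ?X \<union> ?Y" by auto
  then have "card {t \<in> grid N. l \<le> y t} \<le> card (?X \<union> ?Y)" by (intro card_mono) auto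
  also have "\<dots> \<le> card ?X + card ?Y" by (rule card_Un_le)
  finally have "real (card {t \<in> grid N. l \<le> y t}) \<le> real (card ?X) + real (card ?Y)" by linarith
  also have "\<dots> \<le> (A + C * 2 powr p) * \<omega> + C / l powr p * W"
    using X Y by (simp add: algebra_simps)
  also have "(A + C * 2 powr p) * \<omega> \<le>
      (A + C * 2 powr p) * (2 * (\<Sum>t | t \<in> grid N \<and> l < 2 * w t. w t) / l)"
    using size l A C unfolding \<omega>_def by (intro mult_left_mono) (auto simp: pos_le_divide_eq mult.commute)
  also have "(A + C * 2 powr p) * (2 * (\<Sum>t | t \<in> grid N \<and> l < 2 * w t. w t) / l) =
      2 * (A + C * 2 powr p) / l * (\<Sum>t | t \<in> grid N \<and> l < 2 * w t. w t)"
    by simp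
  finally show ?thesis by (simp add: W_def)
qed

section \<open>Extrapolation\<close>

theorem corollary4p3:
  fixes \<tau> :: "real set \<Rightarrow> real set" and p :: real
  assumes "\<exists>x :: 'a::banach. x \<noteq> 0"
    and "UMD TYPE('a)"
    and "bij_betw \<tau> dyadic dyadic"
    and "\<forall>I\<in>dyadic. measure lborel (\<tau> I) = measure lborel I"
    and "p \<in> {1<..<2}"
    and "rearrangement_bounded TYPE('a) \<tau> p"
  shows "\<forall>q\<in>{1<..<p}. rearrangement_bounded TYPE('a) \<tau> q"
proof
  fix q assume q: "q \<in> {1<..<p}"
  have inj: "inj_on \<tau> dyadic" and lp: "level_preserving \<tau>"
    using assms(3,4) by (auto simp: bij_betw_def intro: level_preserving_if_measure)
  obtain x :: 'a where x: "x \<noteq> 0" using assms(1) by blast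
  obtain C where C: "0 < C" and bound: "\<And>N (a :: real set \<Rightarrow> 'a).
    (\<Sum>t\<in>grid N. norm (haar_comb N \<tau> a t) powr p) \<le>
      C * (\<Sum>t\<in>grid N. norm (haar_comb N id a t) powr p)"
    using grid_bound_if_rearrangement_bounded[OF assms(6) lp] assms(5) by auto
  define A where "A = 2 * C * (2 * C) powr (p / (2 - p))"
  have A: "0 \<le> A" using C by (simp add: A_def)
  have image: "real (card (grid N \<inter> \<Union>(\<tau> ` {J \<in> dyadic_below N. J \<subseteq> I}))) \<le> A * real (card (grid N \<inter> I))"
    if "I \<in> dyadic" for N I
    using that card_image_descendants_le[OF lp inj _ _ C x bound] assms(5)
    by (auto simp: dyadic_def A_def)
  show "rearrangement_bounded TYPE('a) \<tau> q"
  proof (rule rearrangement_bounded_if_grid_bound[OF lp])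
    fix N and a :: "real set \<Rightarrow> 'a"
    show "(\<Sum>t\<in>grid N. norm (haar_comb N \<tau> a t) powr q) \<le>
      (2 * (A + C * 2 powr p) * q * 2 powr (q - 1) / (q - 1) + C * q / (p - q)) *
        (\<Sum>t\<in>grid N. norm (haar_comb N id a t) powr q)"
    proof (rule discrete_marcinkiewicz)
      show "1 < q" "q < p" using q by auto
      show "0 \<le> 2 * (A + C * 2 powr p)" using A C by simp
      show "real (card {t \<in> grid N. l \<le> norm (haar_comb N \<tau> a t)}) \<le>
        2 * (A + C * 2 powr p) / l *
          (\<Sum>t | t \<in> grid N \<and> l < 2 * norm (haar_comb N id a t). norm (haar_comb N id a t))
        + C / l powr p *
          (\<Sum>t | t \<in> grid N \<and> norm (haar_comb N id a t) \<le> l. norm (haar_comb N id a t) powr p)"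
        if "0 < l" for l
        using assms(5) C by (intro weak_type_estimate lp bound image A that) auto
    qed (use C in auto)
  qed (use q A C in auto)
qed

end
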